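(* For all $k,m\in\mathbb Z$, the restrictions of $\psi_k,\psi^*_k$ to $\mathcal B^{(m)}$ are given by $$\psi_k|_{\mathcal B^{(m)}}=\sum_{p\in\mathbb Z}(-1)^p\,h^{(p)}_{k-m-1}\,D_p\,z,$$ $$\psi^*_k|_{\mathcal B^{(m)}}=(-1)^{k-m+1}\sum_{p\in\mathbb Z}(-1)^p\,e^{(p)}_{k-m+1}\,D^{(-p)}\,z^{-1},$$ where $h^{(p)}_{k-m-1}$, $e^{(p)}_{k-m+1}$, $z$, $z^{-1}$ denote multiplication operators.
   Context: Setting. Let $B=\mathbb C[h^{(0)}_1,h^{(0)}_2,\dots]$ be the polynomial ring in independent variables $h^{(0)}_k$ ($k>0$), with $h^{(0)}_0=1$ and $h^{(0)}_k=0$ for $k<0$. $B$ is graded by $\deg h^{(0)}_n=n$, and $B^{\le n}$ is the sum of the homogeneous components of degree $\le n$. Let $\{h^{(r)}_k\}_{k,r\in\mathbb Z}$ be a family of elements of $B$ (extending the $h^{(0)}_k$) with $h^{(r)}_k\in B^{\le k+r}$, $h^{(k)}_{-k}=1$ for all $k\in\mathbb Z$, and $h^{(r)}_k=0$ whenever $k+r<0$. For an integer vector $\lambda=(\lambda_1,\dots,\lambda_l)$ (parts may be negative and in any order), extended by $\lambda_i=0$ for $i>l$, let $s_\lambda\in B$ be the stable value, for large $N$, of $\det\left[h^{(j-1)}_{\lambda_i-i+1}\right]_{1\le i,j\le N}$ (the value is the same for all $N\ge l$). For partitions these are the generalized Schur functions, and it is required that $\{s_\lambda\}$, $\lambda$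 ranging over all partitions, is a linear basis of $B$. Generalized elementary symmetric functions: for $a,p\in\mathbb Z$, $e^{(p)}_a=0$ if $p<a$, $e^{(p)}_a=1$ if $p=a$, and $e^{(p)}_a=\det\left[h^{(-p+j)}_{p+1-i}\right]_{1\le i,j\le p-a}$ if $p>a$. Let $z$ be a variable, $\mathcal B^{(m)}=z^mB$, $\mathcal B=\bigoplus_{m\in\mathbb Z}\mathcal B^{(m)}=B[z,z^{-1}]$, with linear basis $\{s_\lambda z^m\}$ ($\lambda$ a partition, $m\in\mathbb Z$). The linear operators $\psi_k,\psi_k^*$ on $\mathcal B$ are defined on this basis by $$\psi_k(s_\lambda z^m)=s_{(k-m-1,\lambda_1,\lambda_2,\dots)}z^{m+1},$$ $$\psi^*_k(s_\lambda z^m)=\sum_{t=1}^\infty(-1)^{t+1}\delta_{k-m-1,\,\lambda_t-t}\;s_{(\lambda_1+1,\dots,\lambda_{t-1}+1,\lambda_{t+1},\lambda_{t+2},\dots)}z^{m-1}.$$ The linear operators $D_p$ and $D^{(p)}$ ($p\in\mathbb Z$) on $B$ are defined on the basis elements $s_\lambda$, $\lambda=(\lambda_1\ge\dots\ge\lambda_l\ge 0)$, by $$D_p(s_\lambda)=\det\left[h^{(j)}_{\lambda_i-i}\right]_{i=1,\dots,l;\;j=0,1,\dots,\widehat p,\dots,l}\ \text{ if }0\le p\le l,\qquad D_p(s_\lambda)=0\ \text{ otherwise}$$ (the column $j=p$ is omitted; this does not depend on appending zero parts to $\lambda$), and $$D^{(p)}(s_\lambda)=\sum_{t=1}^\infty(-1)^{t+1}h^{(p)}_{\lambda_t-t+2}\,s_{(\lambda_1+1,\dots,\lambda_{t-1}+1,\lambda_{t+1},\lambda_{t+2},\dots)},$$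 where $\lambda_t=0$ for $t>l$ (a finite sum). They are extended to $\mathcal B$ by commuting with multiplication by $z^{\pm1}$. When applied to any element, the sums over $p$ in the claim have only finitely many nonzero terms. *)

theory Defs
  imports "HOL-Library.Poly_Mapping" "Jordan_Normal_Form.Determinant"
begin

text \<open>The polynomial ring \<open>B\<close>. The variable with index \<open>n\<close> (starting from \<open>0\<close>) stands for
  \<open>h\<^sub>n\<^sub>+\<^sub>1\<close> with upper index \<open>0\<close>, so it has degree \<open>n + 1\<close>.\<close>

type_synonym polB = "(nat \<Rightarrow>\<^sub>0 nat) \<Rightarrow>\<^sub>0 complex"

definition h0 :: "int \<Rightarrow> polB" where
  "h0 k = (if k < 0 then 0 else if k = 0 then 1
     else Poly_Mapping.single (Poly_Mapping.single (nat k - 1) 1) 1)"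

definition scaleB :: "complex \<Rightarrow> polB \<Rightarrow> polB" where
  "scaleB c f = Poly_Mapping.single 0 c * f"

global_interpretation B: vector_space scaleB
  by unfold_locales
    (simp_all add: scaleB_def algebra_simps single_add mult_single flip: mult.assoc single_one)

definition mdeg :: "(nat \<Rightarrow>\<^sub>0 nat) \<Rightarrow> nat" where
  "mdeg a = (\<Sum>n\<in>Poly_Mapping.keys a. (n + 1) * Poly_Mapping.lookup a n)"

definition B_hom :: "nat \<Rightarrow> polB set" where
  "B_hom d = {f. \<forall>a\<in>Poly_Mapping.keys f. mdeg a = d}"

definition B_le :: "int \<Rightarrow> polB set" where
  "B_le n = B.span (\<Union>d\<in>{d. int d \<le> n}. B_hom d)"


text \<open>The Laurent polynomial ring over \<open>B\<close> in \<open>z\<close>: the term \<open>b z\<^sup>m\<close> is \<^term>\<open>Poly_Mapping.single m b\<close>.\<close>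

type_synonym polBz = "int \<Rightarrow>\<^sub>0 polB"

definition scaleBz :: "complex \<Rightarrow> polBz \<Rightarrow> polBz" where
  "scaleBz c F = Poly_Mapping.single 0 (Poly_Mapping.single 0 c) * F"

global_interpretation Bz: vector_space scaleBz
  by unfold_locales
    (simp_all add: scaleBz_def algebra_simps single_add mult_single flip: mult.assoc single_one)

definition zvar :: polBz where "zvar = Poly_Mapping.single 1 1"

definition zvar_inv :: polBz where "zvar_inv = Poly_Mapping.single (-1) 1"

definition Bz_part :: "int \<Rightarrow> polBz set" where
  "Bz_part m = {Poly_Mapping.single m b | b. True}"

definition constz :: "polB \<Rightarrow> polBz" where
  "constz b = Poly_Mapping.single 0 b"


definition is_basis ::
  "(complex \<Rightarrow> 'b \<Rightarrow> 'b) \<Rightarrow> 'i set \<Rightarrow> ('i \<Rightarrow> 'b::ab_group_add) \<Rightarrow> bool" where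
  "is_basis scl I b \<longleftrightarrow>
     inj_on b I \<and> \<not> module.dependent scl (b ` I) \<and> module.span scl (b ` I) = UNIV"

text \<open>The linear operator with prescribed values \<open>g i\<close> on the elements \<open>b i\<close> of a basis; it is
  meaningful only when \<open>b\<close> is a basis.\<close>

definition lin_op ::
  "(complex \<Rightarrow> 'b \<Rightarrow> 'b) \<Rightarrow> 'i set \<Rightarrow> ('i \<Rightarrow> 'b::ab_group_add) \<Rightarrow> ('i \<Rightarrow> 'b) \<Rightarrow> 'b \<Rightarrow> 'b" where
  "lin_op scl I b g = (THE f. Vector_Spaces.linear scl scl f \<and> (\<forall>i\<in>I. f (b i) = g i))"

definition altsign :: "int \<Rightarrow> 'a::comm_ring_1" where
  "altsign p = (if even p then 1 else -1)"


text \<open>Integer vectors extended by zeros are finitely supported functions \<^typ>\<open>nat \<Rightarrow> int\<close> with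
  indices from \<open>0\<close>: the part usually written \<open>\<mu>\<^sub>i\<close> with \<open>i \<ge> 1\<close> is \<open>\<mu> (i - 1)\<close>. The formulas
  below are shifted accordingly. In \<open>h r k\<close> the first argument is the upper index.\<close>

definition partitions :: "(nat \<Rightarrow> int) set" where
  "partitions = {\<mu>. antimono \<mu> \<and> (\<forall>i. 0 \<le> \<mu> i) \<and> finite {i. \<mu> i \<noteq> 0}}"

definition plength :: "(nat \<Rightarrow> int) \<Rightarrow> nat" where
  "plength \<mu> = card {i. \<mu> i \<noteq> 0}"

definition prepend :: "int \<Rightarrow> (nat \<Rightarrow> int) \<Rightarrow> nat \<Rightarrow> int" where
  "prepend a \<mu> = (\<lambda>i. if i = 0 then a else \<mu> (i - 1))"

text \<open>The vector \<open>(\<mu>\<^sub>1 + 1, \<dots>, \<mu>\<^sub>t\<^sub>-\<^sub>1 + 1, \<mu>\<^sub>t\<^sub>+\<^sub>1, \<mu>\<^sub>t\<^sub>+\<^sub>2, \<dots>)\<close>, in one-based notation, is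
  \<open>drop_part (t - 1) \<mu>\<close>.\<close>

definition drop_part :: "nat \<Rightarrow> (nat \<Rightarrow> int) \<Rightarrow> nat \<Rightarrow> int" where
  "drop_part t \<mu> = (\<lambda>i. if i < t then \<mu> i + 1 else \<mu> (i + 1))"

text \<open>The determinant does not depend on \<open>N\<close> once \<open>\<mu>\<close> vanishes from \<open>N\<close> on; \<open>schur\<close> is this
  stable value.\<close>

definition schur :: "(int \<Rightarrow> int \<Rightarrow> polB) \<Rightarrow> (nat \<Rightarrow> int) \<Rightarrow> polB" where
  "schur h \<mu> = (THE s. \<forall>\<^sub>F N in sequentially.
     det (mat N N (\<lambda>(i, j). h (int j) (\<mu> i - int i))) = s)"

definition gen_elem :: "(int \<Rightarrow> int \<Rightarrow> polB) \<Rightarrow> int \<Rightarrow> int \<Rightarrow> polB" where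
  "gen_elem h p a =
     (if p < a then 0 else if p = a then 1
      else det (mat (nat (p - a)) (nat (p - a)) (\<lambda>(i, j). h (- p + int j + 1) (p - int i))))"


definition psi :: "(int \<Rightarrow> int \<Rightarrow> polB) \<Rightarrow> int \<Rightarrow> polBz \<Rightarrow> polBz" where
  "psi h k = lin_op scaleBz (partitions \<times> UNIV)
     (\<lambda>(\<mu>, m). Poly_Mapping.single m (schur h \<mu>))
     (\<lambda>(\<mu>, m). Poly_Mapping.single (m + 1) (schur h (prepend (k - m - 1) \<mu>)))"

definition psi_star :: "(int \<Rightarrow> int \<Rightarrow> polB) \<Rightarrow> int \<Rightarrow> polBz \<Rightarrow> polBz" where
  "psi_star h k = lin_op scaleBz (partitions \<times> UNIV)
     (\<lambda>(\<mu>, m). Poly_Mapping.single m (schur h \<mu>))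
     (\<lambda>(\<mu>, m). Poly_Mapping.single (m - 1)
        (Sum_any (\<lambda>t::nat. (-1) ^ t * (if k - m - 1 = \<mu> t - int t - 1 then 1 else 0)
           * schur h (drop_part t \<mu>))))"

text \<open>\<open>D_low h p\<close> is \<open>D\<^sub>p\<close> and \<open>D_up h p\<close> is \<open>D\<close> with upper index \<open>(p)\<close>, both on \<open>B\<close>. In
  \<open>D_low\<close> the column indices run through \<open>0, \<dots>, l\<close> without \<open>p\<close>.\<close>

definition D_low :: "(int \<Rightarrow> int \<Rightarrow> polB) \<Rightarrow> int \<Rightarrow> polB \<Rightarrow> polB" where
  "D_low h p = lin_op scaleB partitions (schur h)
     (\<lambda>\<mu>. let l = plength \<mu> in
        if 0 \<le> p \<and> p \<le> int l
        then det (mat l l (\<lambda>(i, j). h (if int j < p then int j else int j + 1) (\<mu> i - int i - 1)))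
        else 0)"

definition D_up :: "(int \<Rightarrow> int \<Rightarrow> polB) \<Rightarrow> int \<Rightarrow> polB \<Rightarrow> polB" where
  "D_up h p = lin_op scaleB partitions (schur h)
     (\<lambda>\<mu>. Sum_any (\<lambda>t::nat. (-1) ^ t * h p (\<mu> t - int t + 1) * schur h (drop_part t \<mu>)))"

text \<open>Extension of an operator on \<open>B\<close> to Laurent polynomials, commuting with
  multiplication by \<open>z\<close> and its inverse.\<close>

definition extz :: "(polB \<Rightarrow> polB) \<Rightarrow> polBz \<Rightarrow> polBz" where
  "extz D F = (\<Sum>m\<in>Poly_Mapping.keys F. Poly_Mapping.single m (D (Poly_Mapping.lookup F m)))"

end

theory Submission
  imports Defs
begin

text \<open>Expanding the determinant for \<open>s\<close> of \<open>(k - m - 1, \<lambda>)\<close> along its first row gives the formula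
  for \<open>\<psi>\<^sub>k\<close>. For \<open>\<psi>\<^sup>*\<^sub>k\<close>, put \<open>H\<^sub>q\<^sub>p = h\<close> with upper index \<open>- p\<close> and lower index \<open>q\<close>. The hypotheses say
  that this infinite matrix is lower unitriangular, and the elements \<open>e\<close> are the minors which are, up
  to the sign \<open>(- 1)\<^sup>p\<^sup>+\<^sup>a\<close>, the entries of its inverse. So the sum over \<open>p\<close> of the products of \<open>e\<close> and
  \<open>h\<close> collapses to the Kronecker delta in the definition of \<open>\<psi>\<^sup>*\<^sub>k\<close>.\<close>

section \<open>Determinants\<close>

lemma det_unit_first_column:
  fixes A :: "'a::comm_ring_1 mat"
  assumes A: "A \<in> carrier_mat (Suc n) (Suc n)"
    and diag: "A $$ (0, 0) = 1" and below: "\<And>i. 0 < i \<Longrightarrow> i < Suc n \<Longrightarrow> A $$ (i, 0) = 0"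
  shows "det A = det (mat n n (\<lambda>(i, j). A $$ (Suc i, Suc j)))"
proof -
  have "det A = (\<Sum>i<Suc n. A $$ (i, 0) * cofactor A i 0)"
    by (rule laplace_expansion_column[OF A]) simp
  also have "\<dots> = (\<Sum>i\<in>{0}. A $$ (i, 0) * cofactor A i 0)"
    by (rule sum.mono_neutral_right) (auto simp: below)
  also have "\<dots> = det (mat_delete A 0 0)"
    by (simp add: diag cofactor_def)
  also have "mat_delete A 0 0 = mat n n (\<lambda>(i, j). A $$ (Suc i, Suc j))"
    using A by (intro eq_matI) (auto simp: mat_delete_def)
  finally show ?thesis .
qed

text \<open>Expansion along the last row leaves one term, of sign \<open>(-1)^(n + n) = 1\<close>.
  This is what makes the determinants defining \<open>schur\<close> stable in their size.\<close>

lemma det_unit_last_row: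
  fixes A :: "'a::comm_ring_1 mat"
  assumes A: "A \<in> carrier_mat (Suc n) (Suc n)"
    and diag: "A $$ (n, n) = 1" and left: "\<And>j. j < n \<Longrightarrow> A $$ (n, j) = 0"
  shows "det A = det (mat n n (\<lambda>(i, j). A $$ (i, j)))"
proof -
  have "det A = (\<Sum>j<Suc n. A $$ (n, j) * cofactor A n j)"
    by (rule laplace_expansion_row[OF A]) simp
  also have "\<dots> = (\<Sum>j\<in>{n}. A $$ (n, j) * cofactor A n j)"
    by (rule sum.mono_neutral_right) (auto simp: left)
  also have "\<dots> = det (mat_delete A n n)"
    by (simp add: diag cofactor_def flip: mult_2)
  also have "mat_delete A n n = mat n n (\<lambda>(i, j). A $$ (i, j))"
    using A by (intro eq_matI) (auto simp: mat_delete_def)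
  finally show ?thesis .
qed

text \<open>Iterating \<open>det_unit_first_column\<close> strips the leading \<open>k\<close> rows
  and columns. Entries above the diagonal may be arbitrary, since each column expansion meets only
  the diagonal 1. It serves to shrink the minors of an elementary determinant.\<close>

lemma det_unitriangular_columns:
  fixes A :: "'a::comm_ring_1 mat"
  assumes "A \<in> carrier_mat (k + n) (k + n)"
    and "\<And>c. c < k \<Longrightarrow> A $$ (c, c) = 1"
    and "\<And>c r. c < k \<Longrightarrow> c < r \<Longrightarrow> r < k + n \<Longrightarrow> A $$ (r, c) = 0"
  shows "det A = det (mat n n (\<lambda>(i, j). A $$ (k + i, k + j)))"
  using assms
proof (induction k arbitrary: A)
  case 0
  then have "mat n n (\<lambda>(i, j). A $$ (0 + i, 0 + j)) = A"
    by (intro eq_matI) auto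
  then show ?case by simp
next
  case (Suc k)
  let ?B = "mat (k + n) (k + n) (\<lambda>(i, j). A $$ (Suc i, Suc j))"
  have "det A = det ?B"
    by (rule det_unit_first_column) (use Suc.prems in auto)
  also have "\<dots> = det (mat n n (\<lambda>(i, j). ?B $$ (k + i, k + j)))"
    by (rule Suc.IH) (use Suc.prems in auto)
  also have "mat n n (\<lambda>(i, j). ?B $$ (k + i, k + j)) = mat n n (\<lambda>(i, j). A $$ (Suc k + i, Suc k + j))"
    by (intro eq_matI) auto
  finally show ?case .
qed

section \<open>Linear operators given on a basis\<close>

text \<open>Spanning makes a linear map with prescribed values unique, and \<open>f\<close>
  witnesses existence, so the definite description in \<open>lin_op\<close> denotes
  \<open>f\<close>.\<close>

lemma lin_op_eqI:
  assumes vs: "vector_space scl"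
    and span: "module.span scl (b ` I) = UNIV"
    and lin: "Vector_Spaces.linear scl scl f"
    and eq: "\<And>i. i \<in> I \<Longrightarrow> f (b i) = g i"
  shows "lin_op scl I b g = f"
proof -
  interpret vector_space scl by fact
  interpret vector_space_pair scl scl ..
  show ?thesis
    unfolding lin_op_def
  proof (rule the_equality)
    show "Vector_Spaces.linear scl scl f \<and> (\<forall>i\<in>I. f (b i) = g i)"
      using lin eq by blast
  next
    fix f' assume f': "Vector_Spaces.linear scl scl f' \<and> (\<forall>i\<in>I. f' (b i) = g i)"
    show "f' = f"
    proof
      fix x
      show "f' x = f x"
        by (rule linear_eq_on[of f' f x "b ` I"]) (use f' lin eq span in auto)
    qed
  qed
qed

lemma lin_op_basis:
  assumes vs: "vector_space scl" and basis: "is_basis scl I b"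
  shows linear_lin_op: "Vector_Spaces.linear scl scl (lin_op scl I b g)"
    and lin_op_apply: "i \<in> I \<Longrightarrow> lin_op scl I b g (b i) = g i"
proof -
  interpret vector_space scl by fact
  interpret vector_space_pair scl scl ..
  have ind: "\<not> dependent (b ` I)" and inj: "inj_on b I" and span: "span (b ` I) = UNIV"
    using basis by (auto simp: is_basis_def)
  \<comment> \<open>\<open>inv_into I b\<close> carries the prescribed values from indices over to
    basis vectors; injectivity of \<open>b\<close> makes this consistent.\<close>
  define f where "f = construct (b ` I) (\<lambda>y. g (inv_into I b y))"
  have lin: "Vector_Spaces.linear scl scl f"
    unfolding f_def by (rule linear_construct[OF ind])
  have val: "f (b i) = g i" if "i \<in> I" for i
    using that inj unfolding f_def by (subst construct_basis[OF ind]) auto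
  have "lin_op scl I b g = f"
    by (rule lin_op_eqI[OF vs span lin val])
  with lin val show "Vector_Spaces.linear scl scl (lin_op scl I b g)"
    and "i \<in> I \<Longrightarrow> lin_op scl I b g (b i) = g i"
    by simp_all
qed

lemma linearB_iff:
  "Vector_Spaces.linear scaleB scaleB f \<longleftrightarrow>
     (\<forall>x y. f (x + y) = f x + f y) \<and> (\<forall>c x. f (scaleB c x) = scaleB c (f x))"
  by (auto simp: Vector_Spaces.linear_iff B.vector_space_axioms)

lemma linearB_zero:
  assumes "Vector_Spaces.linear scaleB scaleB f"
  shows "f 0 = 0"
proof -
  have "f (0 + 0) = f 0 + f 0"
    using assms unfolding linearB_iff by blast
  then show ?thesis by simp
qed

text \<open>Multiplication by \<open>c p\<close> or \<open>d\<close> in B commutes with complex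
  scalars, so both sides are linear in \<open>x\<close> and agreement on the basis suffices.\<close>

lemma lin_op_eq_Sum_any:
  assumes basis: "is_basis scaleB I b"
    and fin: "\<And>i. i \<in> I \<Longrightarrow> finite {p. c p * G p i \<noteq> 0}"
    and eq: "\<And>i. i \<in> I \<Longrightarrow> g i = d * Sum_any (\<lambda>p. c p * G p i)"
  shows "finite {p. c p * lin_op scaleB I b (G p) x \<noteq> 0} \<and>
    lin_op scaleB I b g x = d * Sum_any (\<lambda>p. c p * lin_op scaleB I b (G p) x)"
proof -
  define T where "T p x = c p * lin_op scaleB I b (G p) x" for p x
  define L where "L = lin_op scaleB I b g"
  have lin: "Vector_Spaces.linear scaleB scaleB (lin_op scaleB I b g')" for g'
    by (rule linear_lin_op[OF B.vector_space_axioms basis])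
  have T_add: "T p (x + y) = T p x + T p y" and T_scale: "T p (scaleB a x) = scaleB a (T p x)" for p x y a
    using lin[of "G p"] by (auto simp: linearB_iff T_def scaleB_def algebra_simps)
  have L_add: "L (x + y) = L x + L y" and L_scale: "L (scaleB a x) = scaleB a (L x)" for x y a
    using lin[of g] by (auto simp: linearB_iff L_def)
  have "x \<in> B.span (b ` I)"
    using basis by (simp add: is_basis_def)
  \<comment> \<open>Finiteness travels through the induction together with the identity:
    \<open>Sum_any\<close> defaults to 0 on infinite support, so its additivity rests on finite
    supports.\<close>
  then have "finite {p. T p x \<noteq> 0} \<and> L x = d * Sum_any (\<lambda>p. T p x)"
  proof (induction rule: B.span_induct_alt)
    case base
    have "T p 0 = 0" for p
      by (simp add: T_def linearB_zero[OF lin])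
    moreover have "L 0 = 0"
      by (simp add: L_def linearB_zero[OF lin])
    ultimately show ?case by simp
  next
    case (step a v y)
    then obtain i where i: "i \<in> I" "v = b i" by blast
    have Tv: "T p v = c p * G p i" for p
      by (simp add: i T_def lin_op_apply[OF B.vector_space_axioms basis])
    have fv: "finite {p. T p v \<noteq> 0}"
      using fin[OF i(1)] by (simp add: Tv)
    then have fav: "finite {p. scaleB a (T p v) \<noteq> 0}"
      by (rule rev_finite_subset) (auto simp: scaleB_def)
    have "L v = g i"
      by (simp add: L_def i lin_op_apply[OF B.vector_space_axioms basis])
    also have "\<dots> = d * Sum_any (\<lambda>p. T p v)"
      by (simp add: Tv eq i(1))
    finally have Lv: "L v = d * Sum_any (\<lambda>p. T p v)" .
    have "L (scaleB a v) = scaleB a (d * Sum_any (\<lambda>p. T p v))"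
      by (simp add: L_scale Lv)
    also have "\<dots> = d * Sum_any (\<lambda>p. scaleB a (T p v))"
      by (simp add: scaleB_def mult.left_commute Sum_any_right_distrib[OF fv, of "Poly_Mapping.single 0 a"])
    finally have "L (scaleB a v) = d * Sum_any (\<lambda>p. scaleB a (T p v))" .
    moreover have "finite {p. scaleB a (T p v) + T p y \<noteq> 0}"
      by (rule finite_subset[OF _ finite_UnI[OF fav step.IH[THEN conjunct1]]]) auto
    ultimately show ?case
      using step.IH fav
      by (simp add: T_add T_scale L_add Sum_any.distrib distrib_left)
  qed
  then show ?thesis
    by (simp add: T_def L_def)
qed

section \<open>Laurent polynomials\<close>

text \<open>General form of the operators at hand: homogeneous in z of degree \<open>c\<close>, with
  a coefficient map \<open>L m\<close> that may vary with the z-degree, as the index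
  \<open>k - m - 1\<close> does in \<open>psi\<close>. The extension \<open>extz D\<close> is the
  case of shift 0 and a constant family.\<close>

definition shift_op :: "int \<Rightarrow> (int \<Rightarrow> polB \<Rightarrow> polB) \<Rightarrow> polBz \<Rightarrow> polBz" where
  "shift_op c L F =
     (\<Sum>m\<in>Poly_Mapping.keys F. Poly_Mapping.single (m + c) (L m (Poly_Mapping.lookup F m)))"

text \<open>The sum runs over the support of \<open>F\<close> only; \<open>L m 0 = 0\<close> makes
  the formula valid in the remaining degrees too.\<close>

lemma lookup_shift_op:
  assumes "\<And>m. L m 0 = 0"
  shows "Poly_Mapping.lookup (shift_op c L F) n = L (n - c) (Poly_Mapping.lookup F (n - c))"
proof -
  have "Poly_Mapping.lookup (shift_op c L F) n =
      (\<Sum>m\<in>Poly_Mapping.keys F. if m = n - c then L m (Poly_Mapping.lookup F m) else 0)"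
    unfolding shift_op_def lookup_sum
    by (rule sum.cong) (auto simp: lookup_single when_def)
  also have "\<dots> = L (n - c) (Poly_Mapping.lookup F (n - c))"
    by (auto simp: sum.delta in_keys_iff assms)
  finally show ?thesis .
qed

lemma shift_op_single:
  assumes "\<And>m. L m 0 = 0"
  shows "shift_op c L (Poly_Mapping.single m x) = Poly_Mapping.single (m + c) (L m x)"
  by (rule poly_mapping_eqI) (auto simp: lookup_shift_op[where L = L] assms lookup_single when_def)

lemma scaleBz_single: "scaleBz c (Poly_Mapping.single m x) = Poly_Mapping.single m (scaleB c x)"
  by (simp add: scaleBz_def scaleB_def mult_single)

lemma lookup_scaleBz: "Poly_Mapping.lookup (scaleBz c F) m = scaleB c (Poly_Mapping.lookup F m)"
  unfolding scaleBz_def scaleB_def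
  by (subst mult_map_scale_conv_mult[symmetric]) (simp add: Poly_Mapping.map.rep_eq when_def)

lemma linear_shift_op:
  assumes "\<And>m. Vector_Spaces.linear scaleB scaleB (L m)"
  shows "Vector_Spaces.linear scaleBz scaleBz (shift_op c L)"
proof -
  have *: "L m 0 = 0" "L m (x + y) = L m x + L m y" "L m (scaleB a x) = scaleB a (L m x)" for m x y a
    using assms[of m] linearB_zero by (auto simp: linearB_iff)
  show ?thesis
    by (auto simp: Vector_Spaces.linear_iff Bz.vector_space_axioms lookup_shift_op[where L = L] *
        lookup_add lookup_scaleBz intro!: poly_mapping_eqI)
qed

lemma span_Bz:
  assumes "B.span (b ` I) = UNIV"
  shows "Bz.span ((\<lambda>(i, m). Poly_Mapping.single m (b i)) ` (I \<times> UNIV)) = UNIV" (is "Bz.span ?S = _")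
proof -
  have single: "Poly_Mapping.single m x \<in> Bz.span ?S" for m x
  proof -
    have "x \<in> B.span (b ` I)" by (simp add: assms)
    then show ?thesis
    proof (induction rule: B.span_induct_alt)
      case (step a v y)
      then have "Poly_Mapping.single m v \<in> Bz.span ?S"
        by (auto intro!: Bz.span_base)
      with step show ?case
        by (simp add: single_add Bz.span_add Bz.span_scale flip: scaleBz_single)
    qed (simp add: Bz.span_zero)
  qed
  \<comment> \<open>With shift 0 and identity maps, \<open>shift_op\<close> writes \<open>F\<close>
    as the finite sum of its terms.\<close>
  have "F = shift_op 0 (\<lambda>_ x. x) F" for F
    by (rule poly_mapping_eqI) (simp add: lookup_shift_op)
  then have "F \<in> Bz.span ?S" for F
    unfolding shift_op_def by (metis (no_types, lifting) Bz.span_sum single)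
  then show ?thesis by blast
qed

text \<open>Reduction from Laurent polynomials to B: values on the basis that shift the z-degree by
  \<open>c\<close> define a \<open>shift_op\<close>, whose coefficient maps are the operators on B
  with the corresponding values.\<close>

lemma lin_op_Bz_single:
  assumes basis: "is_basis scaleB I b"
    and g: "\<And>i m. i \<in> I \<Longrightarrow> g (i, m) = Poly_Mapping.single (m + c) (g' m i)"
  shows "lin_op scaleBz (I \<times> UNIV) (\<lambda>(i, m). Poly_Mapping.single m (b i)) g
      (Poly_Mapping.single m x) = Poly_Mapping.single (m + c) (lin_op scaleB I b (g' m) x)"
proof -
  let ?L = "\<lambda>m. lin_op scaleB I b (g' m)"
  have lin: "Vector_Spaces.linear scaleB scaleB (?L m)" for m
    by (rule linear_lin_op[OF B.vector_space_axioms basis])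
  have "lin_op scaleBz (I \<times> UNIV) (\<lambda>(i, m). Poly_Mapping.single m (b i)) g = shift_op c ?L"
  proof (rule lin_op_eqI[OF Bz.vector_space_axioms span_Bz linear_shift_op[OF lin]])
    show "B.span (b ` I) = UNIV"
      using basis by (simp add: is_basis_def)
  qed (auto simp: shift_op_single[where L = ?L] linearB_zero[OF lin] g
      lin_op_apply[OF B.vector_space_axioms basis])
  then show ?thesis
    by (simp add: shift_op_single[where L = ?L] linearB_zero[OF lin])
qed

lemma extz_single: "D 0 = 0 \<Longrightarrow> extz D (Poly_Mapping.single m x) = Poly_Mapping.single m (D x)"
  using shift_op_single[of "\<lambda>_. D" 0 m x] by (simp add: extz_def shift_op_def)

lemma altsign_square [simp]: "altsign p * altsign p = (1 :: 'a::comm_ring_1)"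
  by (simp add: altsign_def)

lemma altsign_of_nat: "altsign (int n) = ((- 1) ^ n :: 'a::comm_ring_1)"
  by (simp add: altsign_def)

lemma altsign_mult_single:
  "altsign p * Poly_Mapping.single (n::int) (y::polB) = Poly_Mapping.single n (altsign p * y)"
  by (simp add: altsign_def single_uminus)

lemma Sum_any_single:
  fixes y :: "'i \<Rightarrow> polB" and n :: int
  assumes "finite {p. y p \<noteq> 0}"
  shows "Sum_any (\<lambda>p. Poly_Mapping.single n (y p)) = Poly_Mapping.single n (Sum_any y)"
proof -
  have "(\<Sum>p\<in>A. Poly_Mapping.single n (y p)) = Poly_Mapping.single n (\<Sum>p\<in>A. y p)" if "finite A" for A
    using that by induction (auto simp: single_add)
  moreover have "{p. Poly_Mapping.single n (y p) \<noteq> 0} = {p. y p \<noteq> 0}"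
    by (metis lookup_single_eq lookup_zero single_zero)
  ultimately show ?thesis
    using assms by (simp add: Sum_any.expand_set)
qed

text \<open>Common form of both claims: \<open>single n\<close> carries an expansion in B over to
  Laurent polynomials. \<open>G p\<close> prescribes \<open>D_low\<close> or \<open>D_up\<close>,
  \<open>c p\<close> is its coefficient, and \<open>altsign q\<close> is the sign in front of the
  sum.\<close>

lemma lin_op_Bz_expansion:
  fixes I :: "'i set" and b :: "'i \<Rightarrow> polB"
  defines "D \<equiv> \<lambda>G. lin_op scaleB I b G"
  assumes basis: "is_basis scaleB I b"
    and fin: "\<And>i. i \<in> I \<Longrightarrow> finite {p. altsign p * c p * G p i \<noteq> 0}"
    and eq: "\<And>i. i \<in> I \<Longrightarrow> g i = altsign q * Sum_any (\<lambda>p. altsign p * c p * G p i)"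
  shows "finite {p. altsign p * constz (c p) * extz (D (G p)) (Poly_Mapping.single n x) \<noteq> 0} \<and>
    Poly_Mapping.single n (D g x) = altsign q *
      Sum_any (\<lambda>p::int. altsign p * constz (c p) * extz (D (G p)) (Poly_Mapping.single n x))"
proof -
  let ?y = "\<lambda>p. altsign p * c p * D (G p) x"
  have "D G' 0 = 0" for G'
    unfolding D_def by (rule linearB_zero[OF linear_lin_op[OF B.vector_space_axioms basis]])
  then have summand: "altsign p * constz (c p) * extz (D (G p)) (Poly_Mapping.single n x)
      = Poly_Mapping.single n (?y p)" for p
    by (simp add: extz_single constz_def mult.assoc mult_single altsign_mult_single)
  have main: "finite {p. ?y p \<noteq> 0} \<and> D g x = altsign q * Sum_any ?y"
    unfolding D_def by (rule lin_op_eq_Sum_any[OF basis fin eq])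
  then have "finite {p. Poly_Mapping.single n (?y p) \<noteq> 0}"
    by (auto elim!: rev_finite_subset)
  with main show ?thesis
    by (simp add: summand Sum_any_single altsign_mult_single)
qed

section \<open>Generalized Schur functions\<close>

locale unitriangular_family =
  fixes h :: "int \<Rightarrow> int \<Rightarrow> polB"
  assumes h_one: "h n (- n) = 1"
    and h_zero: "n + r < 0 \<Longrightarrow> h r n = 0"
begin

text \<open>Once \<open>N\<close> is at least \<open>l\<close>, the new last row of the matrix of
  size \<open>N + 1\<close> has entries \<open>h j (- N)\<close>, which are 0 for
  \<open>j < N\<close> and 1 for \<open>j = N\<close>. Enlarging the matrix therefore keeps the
  determinant.\<close>

lemma schur_eq_det:
  assumes support: "\<And>i. l \<le> i \<Longrightarrow> \<mu> i = 0"
  shows "schur h \<mu> = det (mat l l (\<lambda>(i, j). h (int j) (\<mu> i - int i)))"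
proof -
  let ?d = "\<lambda>N. det (mat N N (\<lambda>(i, j). h (int j) (\<mu> i - int i)))"
  have stable: "?d N = ?d l" if "l \<le> N" for N
    using that
  proof (induction N rule: dec_induct)
    case (step N)
    have "?d (Suc N) = det (mat N N (\<lambda>(i, j). mat (Suc N) (Suc N) (\<lambda>(i, j). h (int j) (\<mu> i - int i)) $$ (i, j)))"
      by (rule det_unit_last_row) (use step.hyps in \<open>auto simp: support h_one h_zero\<close>)
    also have "\<dots> = ?d N"
      by (rule arg_cong[where f = det], rule eq_matI) auto
    finally show ?case using step.IH by simp
  qed simp
  then have ev: "\<forall>\<^sub>F N in sequentially. ?d N = ?d l"
    by (rule eventually_sequentiallyI)
  show ?thesis
    unfolding schur_def
  proof (rule the_equality)
    show "\<forall>\<^sub>F N in sequentially. ?d N = ?d l" by (fact ev)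
  next
    fix s assume "\<forall>\<^sub>F N in sequentially. ?d N = s"
    with ev have "\<forall>\<^sub>F N::nat in sequentially. s = ?d l"
      by eventually_elim simp
    then show "s = ?d l" by simp
  qed
qed

text \<open>By monotonicity a nonzero part at index \<open>i\<close> forces \<open>i + 1\<close>
  nonzero parts, more than \<open>plength\<close> counts.\<close>

lemma partition_support:
  assumes "\<mu> \<in> partitions" and "plength \<mu> \<le> i"
  shows "\<mu> i = 0"
proof (rule ccontr)
  assume nz: "\<mu> i \<noteq> 0"
  have mono: "antimono \<mu>" and nonneg: "\<And>i. 0 \<le> \<mu> i" and fin: "finite {i. \<mu> i \<noteq> 0}"
    using assms by (auto simp: partitions_def)
  have "\<mu> j \<noteq> 0" if "j \<le> i" for j
    using nz nonneg[of i] antimonoD[OF mono that] by linarith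
  then have "{..i} \<subseteq> {i. \<mu> i \<noteq> 0}" by auto
  then have "card {..i} \<le> plength \<mu>"
    unfolding plength_def by (rule card_mono[OF fin])
  with assms(2) show False by simp
qed

text \<open>Prepending moves each part of \<open>\<mu>\<close> down one row, so row
  \<open>i + 1\<close> involves \<open>\<mu> i - i - 1\<close>. Hence deleting row 0 and column
  \<open>p\<close> leaves precisely the determinant that prescribes
  \<open>D_low h p\<close>.\<close>

lemma schur_prepend:
  assumes mu: "\<mu> \<in> partitions"
  shows "schur h (prepend a \<mu>) = (\<Sum>p = 0..int (plength \<mu>). altsign p * h p a *
    det (mat (plength \<mu>) (plength \<mu>)
      (\<lambda>(i, j). h (if int j < p then int j else int j + 1) (\<mu> i - int i - 1))))"
proof -
  define l where "l = plength \<mu>"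
  define A where "A = mat (Suc l) (Suc l) (\<lambda>(i, j). h (int j) (prepend a \<mu> i - int i))"
  let ?M = "\<lambda>p. mat l l (\<lambda>(i, j). h (if int j < p then int j else int j + 1) (\<mu> i - int i - 1))"
  have A: "A \<in> carrier_mat (Suc l) (Suc l)" by (simp add: A_def)
  have row: "A $$ (0, p) = h (int p) a" if "p < Suc l" for p
    using that by (simp add: A_def prepend_def)
  have minor: "mat_delete A 0 p = ?M (int p)" for p
    by (intro eq_matI) (auto simp: mat_delete_def A_def prepend_def algebra_simps)
  have "schur h (prepend a \<mu>) = det A"
    unfolding A_def
    by (rule schur_eq_det) (auto simp: prepend_def l_def intro!: partition_support[OF mu])
  also have "\<dots> = (\<Sum>p<Suc l. A $$ (0, p) * cofactor A 0 p)"
    by (rule laplace_expansion_row[OF A]) simp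
  also have "\<dots> = (\<Sum>p<Suc l. altsign (int p) * h (int p) a * det (?M (int p)))"
    by (rule sum.cong) (simp_all add: cofactor_def minor altsign_of_nat row ac_simps)
  also have "\<dots> = (\<Sum>p = 0..int l. altsign p * h p a * det (?M p))"
    by (rule sum.reindex_bij_witness[of _ nat int]) auto
  finally show ?thesis by (simp add: l_def)
qed

section \<open>Duality of elementary and complete symmetric functions\<close>

text \<open>The elementary determinant is of Hessenberg type: upper plus lower index is
  \<open>j - i + 1\<close>, giving ones just below the diagonal and zeros further down. Expansion
  along the first row yields the recursion for the inverse of a unitriangular matrix, with
  \<open>p = n - 1 - j\<close>.\<close>

lemma gen_elem_expansion:
  assumes "a < n"
  shows "gen_elem h n a =
    (\<Sum>p = a..n - 1. altsign (n - 1 - p) * h (- p) n * gen_elem h p a)"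
proof -
  define N where "N = nat (n - a)"
  define A where "A = mat N N (\<lambda>(i, j). h (- n + int j + 1) (n - int i))"
  have A: "A \<in> carrier_mat N N" and N: "0 < N" "int N = n - a"
    using \<open>a < n\<close> by (auto simp: A_def N_def)
  have row: "A $$ (0, j) = h (- n + int j + 1) n" if "j < N" for j
    using that by (simp add: A_def)
  have minor: "det (mat_delete A 0 j) = gen_elem h (n - 1 - int j) a" if j: "j < N" for j
  proof -
    define M where "M = N - 1 - j"
    let ?p = "n - 1 - int j"
    have M: "N - Suc 0 = j + M" "nat (?p - a) = M" and p: "?p \<ge> a"
      using j N by (auto simp: M_def)
    have idx: "mat_delete A 0 j $$ (r, c) =
        h (- n + (if c < j then int c else int c + 1) + 1) (n - 1 - int r)"
      if "r < j + M" "c < j + M" for r c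
      using that M by (auto simp: mat_delete_def A_def algebra_simps)
    \<comment> \<open>Deleting row 0 lifts the ones of the first \<open>j\<close> columns onto the
      diagonal, so these columns can be stripped. The remaining block of size
      \<open>M = ?p - a\<close> is again an elementary determinant; for \<open>?p = a\<close> it is
      empty and equals 1.\<close>
    have "det (mat_delete A 0 j) = det (mat M M (\<lambda>(r, c). mat_delete A 0 j $$ (j + r, j + c)))"
    proof (rule det_unitriangular_columns)
      show "mat_delete A 0 j \<in> carrier_mat (j + M) (j + M)"
        using mat_delete_carrier[OF A] M by simp
      show "mat_delete A 0 j $$ (c, c) = 1" if "c < j" for c
        using that h_one[of "- n + int c + 1"] by (simp add: idx algebra_simps)
      show "mat_delete A 0 j $$ (r, c) = 0" if "c < j" "c < r" "r < j + M" for r c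
        using that by (simp add: idx h_zero)
    qed
    also have "mat M M (\<lambda>(r, c). mat_delete A 0 j $$ (j + r, j + c)) =
        mat M M (\<lambda>(r, c). h (- ?p + int c + 1) (?p - int r))"
      by (intro eq_matI) (auto simp: idx algebra_simps)
    also have "det \<dots> = gen_elem h ?p a"
      using p M by (auto simp: gen_elem_def)
    finally show ?thesis .
  qed
  have "gen_elem h n a = det A"
    using \<open>a < n\<close> by (simp add: gen_elem_def A_def N_def)
  also have "\<dots> = (\<Sum>j<N. A $$ (0, j) * cofactor A 0 j)"
    by (rule laplace_expansion_row[OF A N(1)])
  also have "\<dots> = (\<Sum>j<N. altsign (int j) * h (- n + int j + 1) n * gen_elem h (n - 1 - int j) a)"
    by (rule sum.cong) (simp_all add: cofactor_def minor altsign_of_nat row ac_simps)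
  also have "\<dots> = (\<Sum>p = a..n - 1. altsign (n - 1 - p) * h (- p) n * gen_elem h p a)"
    by (rule sum.reindex_bij_witness[of _ "\<lambda>p. nat (n - 1 - p)" "\<lambda>j. n - 1 - int j"])
      (use N in \<open>auto simp: algebra_simps\<close>)
  finally show ?thesis .
qed

text \<open>For \<open>a < n\<close> the term \<open>p = n\<close> cancels the others by the
  recursion, because \<open>altsign n * altsign (n - 1 - p) = - altsign p\<close>. Allowing any
  finite \<open>P\<close> containing \<open>{a..n}\<close> lets one index set serve all rows
  \<open>n\<close> at once.\<close>

lemma gen_elem_h_orthogonal:
  assumes fin: "finite P" and P: "{a..n} \<subseteq> P"
  shows "(\<Sum>p\<in>P. altsign p * gen_elem h p a * h (- p) n) = (if n = a then altsign a else 0)"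
proof -
  let ?f = "\<lambda>p. altsign p * gen_elem h p a * h (- p) n"
  have hn: "h (- n) n = 1"
    using h_one[of "- n"] by simp
  have "(\<Sum>p\<in>P. ?f p) = (\<Sum>p = a..n. ?f p)"
    \<comment> \<open>Outside \<open>{a..n}\<close> either the elementary factor vanishes
      (\<open>p < a\<close>) or the complete one does (\<open>p > n\<close>).\<close>
    by (rule sum.mono_neutral_right[OF fin P]) (auto simp: gen_elem_def h_zero not_le)
  also have "\<dots> = (if n = a then altsign a else 0)"
  proof (cases "a < n")
    case True
    then have "{a..n} = insert n {a..n - 1}" by auto
    then have "(\<Sum>p = a..n. ?f p) = altsign n * gen_elem h n a + (\<Sum>p = a..n - 1. ?f p)"
      by (simp add: hn)
    also have "altsign n * gen_elem h n a =
        (\<Sum>p = a..n - 1. altsign n * (altsign (n - 1 - p) * h (- p) n * gen_elem h p a))"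
      by (simp add: gen_elem_expansion[OF True] sum_distrib_left)
    also have "\<dots> = (\<Sum>p = a..n - 1. - ?f p)"
      by (rule sum.cong) (auto simp: altsign_def)
    finally show ?thesis
      using True by (simp add: sum_negf)
  next
    case False
    then show ?thesis
      using hn by (auto simp: gen_elem_def)
  qed
  finally show ?thesis .
qed

text \<open>For each \<open>t\<close>, orthogonality is applied to row
  \<open>\<mu> t - t + 1\<close>. It selects \<open>\<mu> t - t + 1 = a\<close>, which for
  \<open>a = k - m + 1\<close> is the delta condition of \<open>psi_star\<close>. The vectors
  \<open>S t\<close> stay arbitrary, since they are merely carried along.\<close>

lemma D_up_expansion:
  fixes S :: "nat \<Rightarrow> polB"
  assumes mono: "antimono \<mu>"
  defines "G \<equiv> \<lambda>p. Sum_any (\<lambda>t::nat. (- 1) ^ t * h (- p) (\<mu> t - int t + 1) * S t)"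
  shows "finite {p. altsign p * gen_elem h p a * G p \<noteq> 0}"
    and "Sum_any (\<lambda>t::nat. (- 1) ^ t * (if a - 2 = \<mu> t - int t - 1 then 1 else 0) * S t) =
      altsign a * Sum_any (\<lambda>p. altsign p * gen_elem h p a * G p)"
proof -
  \<comment> \<open>Below \<open>a\<close> the elementary factor is 0; above
    \<open>\<mu> 0 + 1\<close> every \<open>h (- p) (\<mu> t - int t + 1)\<close> is 0.\<close>
  define P where "P = {a..\<mu> 0 + 1}"
  \<comment> \<open>For \<open>t\<close> beyond this range \<open>\<mu> t - int t + 1 < a\<close>,
    so the delta fails and \<open>h (- p)\<close> vanishes there for every \<open>p \<ge> a\<close>.
    Both sums are thus finite and may be exchanged.\<close>
  define T where "T = {..nat (\<mu> 0 + 1 - a)}"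
  have bound: "\<mu> t \<le> \<mu> 0" for t
    using mono by (rule antimonoD) simp
  have outside: "\<mu> t - int t + 1 < a" if "t \<notin> T" for t
    using that bound[of t] by (auto simp: T_def)
  have G: "G p = (\<Sum>t\<in>T. (- 1) ^ t * h (- p) (\<mu> t - int t + 1) * S t)" if "a \<le> p" for p
    unfolding G_def
  proof (rule Sum_any.expand_superset)
    show "{t. (- 1) ^ t * h (- p) (\<mu> t - int t + 1) * S t \<noteq> 0} \<subseteq> T"
      using outside that by (force intro: h_zero)
  qed (simp add: T_def)
  have supp: "{p. altsign p * gen_elem h p a * G p \<noteq> 0} \<subseteq> P"
  proof
    fix p assume "p \<in> {p. altsign p * gen_elem h p a * G p \<noteq> 0}"
    then have nz: "gen_elem h p a \<noteq> 0" "G p \<noteq> 0" by auto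
    then have "a \<le> p"
      by (auto simp: gen_elem_def split: if_splits)
    moreover have "p \<le> \<mu> 0 + 1"
    proof (rule ccontr)
      assume "\<not> p \<le> \<mu> 0 + 1"
      then have "h (- p) (\<mu> t - int t + 1) = 0" for t
        using bound[of t] by (intro h_zero) simp
      with nz show False by (simp add: G_def)
    qed
    ultimately show "p \<in> P" by (simp add: P_def)
  qed
  then show "finite {p. altsign p * gen_elem h p a * G p \<noteq> 0}"
    by (rule finite_subset) (simp add: P_def)
  have "Sum_any (\<lambda>p. altsign p * gen_elem h p a * G p) = (\<Sum>p\<in>P. altsign p * gen_elem h p a * G p)"
    by (rule Sum_any.expand_superset[OF _ supp]) (simp add: P_def)
  also have "\<dots> = (\<Sum>p\<in>P. \<Sum>t\<in>T. (- 1) ^ t * S t *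
      (altsign p * gen_elem h p a * h (- p) (\<mu> t - int t + 1)))"
    by (rule sum.cong) (simp_all add: G P_def sum_distrib_left ac_simps)
  also have "\<dots> = (\<Sum>t\<in>T. (- 1) ^ t * S t *
      (\<Sum>p\<in>P. altsign p * gen_elem h p a * h (- p) (\<mu> t - int t + 1)))"
    by (subst sum.swap) (simp add: sum_distrib_left)
  also have "\<dots> = (\<Sum>t\<in>T. (- 1) ^ t * S t * (if \<mu> t - int t + 1 = a then altsign a else 0))"
  proof (rule sum.cong[OF refl])
    fix t
    show "(- 1) ^ t * S t * (\<Sum>p\<in>P. altsign p * gen_elem h p a * h (- p) (\<mu> t - int t + 1)) =
        (- 1) ^ t * S t * (if \<mu> t - int t + 1 = a then altsign a else 0)"
      using bound[of t] by (subst gen_elem_h_orthogonal) (auto simp: P_def)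
  qed
  finally have "altsign a * Sum_any (\<lambda>p. altsign p * gen_elem h p a * G p) =
      (\<Sum>t\<in>T. (- 1) ^ t * (if a - 2 = \<mu> t - int t - 1 then 1 else 0) * S t)"
    unfolding sum_distrib_left
    by (auto simp: sum_distrib_left mult.left_commute[of "altsign a"] intro!: sum.cong)
  moreover have "Sum_any (\<lambda>t::nat. (- 1) ^ t * (if a - 2 = \<mu> t - int t - 1 then 1 else 0) * S t) =
      (\<Sum>t\<in>T. (- 1) ^ t * (if a - 2 = \<mu> t - int t - 1 then 1 else 0) * S t)"
  proof (rule Sum_any.expand_superset)
    show "{t. (- 1) ^ t * (if a - 2 = \<mu> t - int t - 1 then 1 else 0) * S t \<noteq> 0} \<subseteq> T"
      using outside by force
  qed (simp add: T_def)
  ultimately show "Sum_any (\<lambda>t::nat. (- 1) ^ t * (if a - 2 = \<mu> t - int t - 1 then 1 else 0) * S t) =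
      altsign a * Sum_any (\<lambda>p. altsign p * gen_elem h p a * G p)"
    by simp
qed

end

section \<open>The two operator identities on a fixed power of z\<close>

theorem proposition4p2:
  fixes h :: "int \<Rightarrow> int \<Rightarrow> polB" and k m :: int
  assumes h_0: "\<And>n. h 0 n = h0 n"
    and h_le: "\<And>r n. h r n \<in> B_le (n + r)"
    and h_one: "\<And>n. h n (- n) = 1"
    and h_zero: "\<And>r n. n + r < 0 \<Longrightarrow> h r n = 0"
    and schur_basis: "is_basis scaleB partitions (schur h)"
  shows "(\<forall>F\<in>Bz_part m.
      finite {p. altsign p * constz (h p (k - m - 1)) * extz (D_low h p) (zvar * F) \<noteq> 0} \<and>
      psi h k F = Sum_any (\<lambda>p::int.
        altsign p * constz (h p (k - m - 1)) * extz (D_low h p) (zvar * F))) \<and>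
    (\<forall>F\<in>Bz_part m.
      finite {p. altsign p * constz (gen_elem h p (k - m + 1)) * extz (D_up h (- p)) (zvar_inv * F) \<noteq> 0} \<and>
      psi_star h k F = altsign (k - m + 1) * Sum_any (\<lambda>p::int.
        altsign p * constz (gen_elem h p (k - m + 1)) * extz (D_up h (- p)) (zvar_inv * F)))"
proof (intro conjI[of "Ball _ _"] ballI)
  interpret unitriangular_family h
    by unfold_locales (fact h_one, fact h_zero)
  fix F assume "F \<in> Bz_part m"
  then obtain x where F: "F = Poly_Mapping.single m x"
    by (auto simp: Bz_part_def)
  let ?a = "k - m - 1"
  let ?G = "\<lambda>p \<mu>. let l = plength \<mu> in
        if 0 \<le> p \<and> p \<le> int l
        then det (mat l l (\<lambda>(i, j). h (if int j < p then int j else int j + 1) (\<mu> i - int i - 1)))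
        else 0"
  \<comment> \<open>The prescribed value of \<open>D_low h p\<close> is 0 unless
    \<open>0 \<le> p \<le> l\<close>, which turns the finite row expansion into a sum over all
    integers.\<close>
  have supp: "{p. altsign p * h p ?a * ?G p \<mu> \<noteq> 0} \<subseteq> {0..int (plength \<mu>)}" for \<mu>
    by (auto simp: Let_def split: if_splits)
  have zF: "zvar * F = Poly_Mapping.single (m + 1) x"
    by (simp add: F zvar_def mult_single add.commute)
  let ?L = "lin_op scaleB partitions (schur h)"
  let ?T = "\<lambda>p. altsign p * constz (h p ?a) * extz (?L (?G p)) (Poly_Mapping.single (m + 1) x)"
  have psi: "psi h k F =
      Poly_Mapping.single (m + 1) (?L (\<lambda>\<mu>. schur h (prepend ?a \<mu>)) x)"
    unfolding F psi_def by (rule lin_op_Bz_single[OF schur_basis]) simp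
  \<comment> \<open>This identity has no sign in front of its sum; \<open>altsign 0 = 1\<close>
    fills that place of \<open>lin_op_Bz_expansion\<close>.\<close>
  have *: "finite {p. ?T p \<noteq> 0} \<and>
      Poly_Mapping.single (m + 1) (?L (\<lambda>\<mu>. schur h (prepend ?a \<mu>)) x) =
      altsign 0 * Sum_any (\<lambda>p::int. ?T p)"
  proof (rule lin_op_Bz_expansion[OF schur_basis])
    fix \<mu> assume mu: "\<mu> \<in> partitions"
    show "finite {p. altsign p * h p ?a * ?G p \<mu> \<noteq> 0}"
      by (rule finite_subset[OF supp]) simp
    have "schur h (prepend ?a \<mu>) = (\<Sum>p = 0..int (plength \<mu>). altsign p * h p ?a * ?G p \<mu>)"
      unfolding schur_prepend[OF mu] by (rule sum.cong) (simp_all add: Let_def)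
    also have "\<dots> = Sum_any (\<lambda>p. altsign p * h p ?a * ?G p \<mu>)"
      by (rule Sum_any.expand_superset[symmetric, OF _ supp]) simp
    finally show "schur h (prepend ?a \<mu>) = altsign 0 * Sum_any (\<lambda>p. altsign p * h p ?a * ?G p \<mu>)"
      by (simp add: altsign_def)
  qed
  then show "finite {p. altsign p * constz (h p ?a) * extz (D_low h p) (zvar * F) \<noteq> 0} \<and>
      psi h k F = Sum_any (\<lambda>p::int. altsign p * constz (h p ?a) * extz (D_low h p) (zvar * F))"
    unfolding zF psi D_low_def by (simp add: altsign_def[of 0])
next
  interpret unitriangular_family h
    by unfold_locales (fact h_one, fact h_zero)
  fix F assume "F \<in> Bz_part m"
  then obtain x where F: "F = Poly_Mapping.single m x"
    by (auto simp: Bz_part_def)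
  let ?a = "k - m + 1"
  let ?g = "\<lambda>m \<mu>. Sum_any (\<lambda>t::nat. (-1) ^ t * (if k - m - 1 = \<mu> t - int t - 1 then 1 else 0)
           * schur h (drop_part t \<mu>))"
  have zF: "zvar_inv * F = Poly_Mapping.single (m - 1) x"
    by (simp add: F zvar_inv_def mult_single)
  have psi: "psi_star h k F =
      Poly_Mapping.single (m - 1) (lin_op scaleB partitions (schur h) (?g m) x)"
    \<comment> \<open>Writing \<open>m - 1\<close> as \<open>m + (- 1)\<close> exhibits the z-degree
      shift \<open>c = - 1\<close>.\<close>
    unfolding F psi_star_def diff_conv_add_uminus[of m 1]
    by (rule lin_op_Bz_single[OF schur_basis]) simp
  show "finite {p. altsign p * constz (gen_elem h p ?a) * extz (D_up h (- p)) (zvar_inv * F) \<noteq> 0} \<and>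
      psi_star h k F = altsign ?a *
        Sum_any (\<lambda>p::int. altsign p * constz (gen_elem h p ?a) * extz (D_up h (- p)) (zvar_inv * F))"
    unfolding zF psi D_up_def
  proof (rule lin_op_Bz_expansion[OF schur_basis])
    fix \<mu> :: "nat \<Rightarrow> int" assume "\<mu> \<in> partitions"
    then have mono: "antimono \<mu>" by (simp add: partitions_def)
    note expansion = D_up_expansion[OF mono, where a = ?a and S = "\<lambda>t. schur h (drop_part t \<mu>)"]
    show "finite {p. altsign p * gen_elem h p ?a *
        Sum_any (\<lambda>t::nat. (-1) ^ t * h (- p) (\<mu> t - int t + 1) * schur h (drop_part t \<mu>)) \<noteq> 0}"
      by (rule expansion(1))
    \<comment> \<open>The delta in \<open>psi_star\<close> is indexed by \<open>k - m - 1\<close>,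
      two below the lower index \<open>?a\<close> of the elementary functions.\<close>
    have "k - m - 1 = ?a - 2" by simp
    then show "?g m \<mu> = altsign ?a * Sum_any (\<lambda>p. altsign p * gen_elem h p ?a *
        Sum_any (\<lambda>t::nat. (-1) ^ t * h (- p) (\<mu> t - int t + 1) * schur h (drop_part t \<mu>)))"
      using expansion(2) by simp
  qed
qed

end
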